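(* Let $\mathbf{U}=(U_1,U_2,\dots,U_n)\sim \mathrm{MVN}\big(\mathbf{0},(1-\rho)I+\rho\,\mathbf{1}\mathbf{1}'\big)$. Then there exist independent random variables $Z_1,\dots,Z_n,V$ with $Z_i\stackrel{\text{i.i.d.}}{\sim} N(0,1-\rho)$ for $i=1,\dots,n$ and $V\sim N(0,\rho)$ such that $$(U_1,U_2,\dots,U_n)\stackrel{d}{=}(Z_1+V,Z_2+V,\dots,Z_n+V).$$
   Context: $I$ is the $n\times n$ identity matrix, $\mathbf{1}=(1,\dots,1)'$ is the all-ones column vector of length $n$, and $\rho$ is the common correlation coefficient of every pair of distinct components of $\mathbf{U}$. $\mathrm{MVN}(\mathbf{m},\Sigma)$ denotes the multivariate normal distribution with mean vector $\mathbf{m}$ and covariance matrix $\Sigma$, and $N(m,v)$ denotes the normal distribution with mean $m$ and variance $v$. The symbol $\stackrel{d}{=}$ denotes equality in distribution.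
   Formalization: The condition 0 ≤ ρ ≤ 1 is assumed explicitly; for other ρ (for example n = 3, ρ = −1/4, where U exists) one of the laws N(0,ρ), N(0,1−ρ) has negative variance and is undefined. *)

theory Defs
  imports "HOL-Probability.Probability"
begin

(* N(m, v), parametrised by the variance v. For v = 0 this is the point mass at m: the formula
   for normal_density degenerates at standard deviation 0, so that case is separate. *)
definition normally_distributed ::
    "'a measure \<Rightarrow> ('a \<Rightarrow> real) \<Rightarrow> real \<Rightarrow> real \<Rightarrow> bool" where
  "normally_distributed M X m v \<longleftrightarrow>
     X \<in> borel_measurable M \<and>
     (v > 0 \<and> distributed M lborel X (normal_density m (sqrt v)) \<or>
      v = 0 \<and> (AE \<omega> in M. X \<omega> = m))"

definition mean_vector :: "'a measure \<Rightarrow> ('a \<Rightarrow> real ^ 'n) \<Rightarrow> real ^ 'n" where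
  "mean_vector M X = (\<chi> i. \<integral>\<omega>. X \<omega> $ i \<partial>M)"

definition covariance_matrix :: "'a measure \<Rightarrow> ('a \<Rightarrow> real ^ 'n) \<Rightarrow> real ^ 'n ^ 'n" where
  "covariance_matrix M X =
     (\<chi> i j. \<integral>\<omega>. (X \<omega> $ i - mean_vector M X $ i) * (X \<omega> $ j - mean_vector M X $ j) \<partial>M)"

(* MVN(m, S), allowing singular S: every linear combination of the components is (possibly
   degenerate) univariate normal. This makes all components square-integrable, so the
   integrals in the mean vector and covariance matrix are never junk values. *)
definition multivariate_normal ::
    "'a measure \<Rightarrow> ('a \<Rightarrow> real ^ 'n) \<Rightarrow> real ^ 'n \<Rightarrow> real ^ 'n ^ 'n \<Rightarrow> bool" where
  "multivariate_normal M X m S \<longleftrightarrow>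
     X \<in> borel_measurable M \<and>
     (\<forall>a :: real ^ 'n. \<exists>\<mu> v. normally_distributed M (\<lambda>\<omega>. a \<bullet> X \<omega>) \<mu> v) \<and>
     mean_vector M X = m \<and>
     covariance_matrix M X = S"

definition equicorrelation_matrix :: "real \<Rightarrow> real ^ 'n ^ 'n" where
  "equicorrelation_matrix \<rho> =
     (1 - \<rho>) *\<^sub>R mat 1 +
     \<rho> *\<^sub>R ((columnvector (vec 1) :: real ^ 1 ^ 'n) ** (rowvector (vec 1) :: real ^ 'n ^ 1))"

end

theory Submission
  imports Defs
begin

text \<open>
  The law of a random vector \<open>U\<close> in Euclidean space is determined by its characteristic function
  \<open>a \<mapsto> E cis (a \<bullet> U)\<close>, so it suffices to compute this function on both sides.

  On the left, \<open>a \<bullet> U\<close> is a centred normal variable, and its variance is the quadratic form of the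
  covariance matrix at \<open>a\<close>, here \<open>(1 - \<rho>) (\<Sum>i. (a $ i)\<^sup>2) + \<rho> (\<Sum>i. a $ i)\<^sup>2\<close>
  (\<open>char_multivariate_normal\<close>, \<open>equicorrelation_quadratic_form\<close>). On the right,
  \<open>a \<bullet> (Z + V 1) = (\<Sum>i. a $ i * Z i) + (\<Sum>i. a $ i) * V\<close>, so independence turns the
  characteristic function into a product of one-dimensional normal ones, whose exponents add up to
  the same quadratic form (\<open>char_common_shift\<close>). Working with characteristic functions
  rather than densities treats the degenerate cases \<open>\<rho> = 0\<close> and \<open>\<rho> = 1\<close> along with the others. The
  independent variables are the coordinates of a finite product of normal laws
  (\<open>ex_indep_normal_family\<close>).

  The substance lies in the uniqueness theorem \<open>measure_eqI_char\<close>. Equal characteristic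
  functions give equal integrals of all trigonometric polynomials. Apply this to polynomials in the
  numbers \<open>sin (r * x \<bullet> b)\<close> for basis vectors \<open>b\<close>: these are trigonometric polynomials in \<open>x\<close>, and
  the vector of sines stays in a cube, on which polynomials are uniformly dense in the continuous
  functions. Hence the two measures agree on \<open>g (sin_vec (r *\<^sub>R x))\<close> for every continuous \<open>g\<close>, where
  \<open>sin_vec\<close> applies the sine coordinatewise. For \<open>g y = f (y /\<^sub>R r)\<close> and \<open>r \<rightarrow> 0\<close> these functions
  converge boundedly to \<open>f x\<close>, so the integrals of every bounded continuous \<open>f\<close> agree.
\<close>

section \<open>Uniqueness of multivariate characteristic functions\<close>

text \<open>
  The indicator of a closed set is the bounded pointwise limit of continuous functions of the
  distance to the set, and the closed sets form an intersection-stable generator.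
\<close>

lemma measure_eqI_bounded_continuous:
  fixes P Q :: "'a::metric_space measure"
  assumes P: "prob_space P" "sets P = sets borel" and Q: "prob_space Q" "sets Q = sets borel"
    and eq: "\<And>f :: 'a \<Rightarrow> real. continuous_on UNIV f \<Longrightarrow> (\<And>x. \<bar>f x\<bar> \<le> 1) \<Longrightarrow>
               (\<integral>x. f x \<partial>P) = (\<integral>x. f x \<partial>Q)"
  shows "P = Q"
proof -
  interpret P: prob_space P by fact
  interpret Q: prob_space Q by fact
  have closed_eq: "emeasure P C = emeasure Q C" if C: "closed C" for C
  proof (cases "C = {}")
    case False
    define f where "f n x = max 0 (1 - real n * infdist x C)" for n x
    have cont: "continuous_on UNIV (f n)" for n
      unfolding f_def by (intro continuous_intros)
    have bd: "\<bar>f n x\<bar> \<le> 1" for n x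
      unfolding f_def using infdist_nonneg[of x C] by (auto simp: abs_if max_def)
    have lim: "(\<lambda>n. f n x) \<longlonglongrightarrow> indicator C x" for x
    proof (cases "x \<in> C")
      case True
      then show ?thesis by (simp add: f_def)
    next
      case out: False
      have pos: "infdist x C > 0"
        using infdist_pos_not_in_closed[OF C False out] .
      obtain k where k: "1 / infdist x C < real k"
        using reals_Archimedean2 by blast
      have "f n x = 0" if "n \<ge> k" for n
      proof -
        have "1 < real k * infdist x C" using k pos by (simp add: field_simps)
        also have "\<dots> \<le> real n * infdist x C" using that pos by (intro mult_right_mono) auto
        finally show ?thesis by (simp add: f_def)
      qed
      then have "eventually (\<lambda>n. f n x = 0) sequentially"
        by (auto simp: eventually_sequentially)
      then show ?thesis using out by (simp add: tendsto_eventually)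
    qed
    have conv: "(\<lambda>n. \<integral>x. f n x \<partial>R) \<longlonglongrightarrow> measure R C"
      if "prob_space R" "sets R = sets borel" for R :: "'a measure"
    proof -
      interpret R: prob_space R by fact
      note [measurable_cong] = that(2)
      have [measurable]: "f n \<in> borel_measurable borel" for n
        using cont by (rule borel_measurable_continuous_onI)
      have [measurable]: "C \<in> sets borel" using C by simp
      have "(\<lambda>n. \<integral>x. f n x \<partial>R) \<longlonglongrightarrow> (\<integral>x. indicator C x \<partial>R)"
        by (rule integral_dominated_convergence[where w = "\<lambda>_. 1"]) (use lim bd in auto)
      moreover have "(\<integral>x. indicator C x \<partial>R) = measure R C"
        using C that(2) by (simp add: Int_absorb2 sets.sets_into_space)
      ultimately show ?thesis by simp
    qed
    have "measure P C = measure Q C"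
      using conv[OF P] conv[OF Q] eq[OF cont bd] by (simp add: LIMSEQ_unique)
    then show ?thesis by (simp add: P.emeasure_eq_measure Q.emeasure_eq_measure)
  qed simp
  show ?thesis
  proof (rule measure_eqI_generator_eq[where E = "Collect closed" and \<Omega> = UNIV and A = "\<lambda>_. UNIV"])
    show "Int_stable (Collect closed)" by (auto simp: Int_stable_def)
    show "sets P = sigma_sets UNIV (Collect closed)" "sets Q = sigma_sets UNIV (Collect closed)"
      using P(2) Q(2) by (simp_all add: borel_eq_closed)
  qed (use closed_eq in auto)
qed

inductive trig_polynomial :: "('a::real_inner \<Rightarrow> complex) \<Rightarrow> bool" where
  monomial: "trig_polynomial (\<lambda>x. c * cis (t \<bullet> x))"
| add: "trig_polynomial f \<Longrightarrow> trig_polynomial g \<Longrightarrow> trig_polynomial (\<lambda>x. f x + g x)"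

lemma trig_polynomial_const: "trig_polynomial (\<lambda>x. c)"
  using trig_polynomial.monomial[of c 0] by simp

lemma trig_polynomial_mult:
  assumes "trig_polynomial f" "trig_polynomial g"
  shows "trig_polynomial (\<lambda>x. f x * g x)"
  using assms
proof (induction f)
  case (monomial c t)
  then show ?case
  proof (induction g)
    case (monomial d s)
    have "trig_polynomial (\<lambda>x. (c * d) * cis ((t + s) \<bullet> x))"
      by (rule trig_polynomial.monomial)
    then show ?case
      by (simp add: inner_add_left flip: cis_mult mult.assoc) (simp add: ac_simps)
  next
    case (add f g)
    then show ?case by (simp add: distrib_left trig_polynomial.add)
  qed
next
  case (add f g)
  then show ?case by (simp add: distrib_right trig_polynomial.add)
qed

lemma trig_polynomial_sum:
  "finite A \<Longrightarrow> (\<And>a. a \<in> A \<Longrightarrow> trig_polynomial (f a)) \<Longrightarrow> trig_polynomial (\<lambda>x. \<Sum>a\<in>A. f a x)"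
  by (induction A rule: finite_induct) (auto intro: trig_polynomial_const trig_polynomial.add)

lemma trig_polynomial_sin: "trig_polynomial (\<lambda>x. complex_of_real (sin (t \<bullet> x)))"
proof -
  have "trig_polynomial (\<lambda>x. (1 / (2 * \<i>)) * cis (t \<bullet> x) + (- 1 / (2 * \<i>)) * cis ((- t) \<bullet> x))"
    by (intro trig_polynomial.intros)
  moreover have "complex_of_real (sin (t \<bullet> x)) =
      (1 / (2 * \<i>)) * cis (t \<bullet> x) + (- 1 / (2 * \<i>)) * cis ((- t) \<bullet> x)" for x
    by (simp add: complex_eq_iff)
  ultimately show ?thesis by presburger
qed

lemma borel_measurable_cis [measurable]: "cis \<in> borel_measurable borel"
  by (intro borel_measurable_continuous_onI continuous_intros)

lemma integral_trig_polynomial_eq: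
  fixes P Q :: "'a::euclidean_space measure"
  assumes P: "prob_space P" "sets P = sets borel" and Q: "prob_space Q" "sets Q = sets borel"
    and char_eq: "\<And>t. (\<integral>x. cis (t \<bullet> x) \<partial>P) = (\<integral>x. cis (t \<bullet> x) \<partial>Q)"
    and f: "trig_polynomial f"
  shows "(\<integral>x. f x \<partial>P) = (\<integral>x. f x \<partial>Q)"
proof -
  have int: "integrable R f" if "prob_space R" "sets R = sets borel" "trig_polynomial f"
    for R :: "'a measure" and f
    using that(3)
  proof (induction f)
    case (monomial c t)
    interpret R: prob_space R by fact
    note [measurable_cong] = that(2)
    show ?case
      by (intro R.integrable_const_bound[where B = "cmod c"]) (auto simp: norm_mult)
  qed simp
  show ?thesis
    using f
  proof (induction f)
    case (monomial c t)
    then show ?case by (simp add: char_eq)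
  next
    case (add f g)
    then show ?case using int[OF P] int[OF Q] by simp
  qed
qed

definition sin_vec :: "'a::euclidean_space \<Rightarrow> 'a" where
  "sin_vec x = (\<Sum>b\<in>Basis. sin (x \<bullet> b) *\<^sub>R b)"

lemma sin_vec_inner: "b \<in> Basis \<Longrightarrow> sin_vec x \<bullet> b = sin (x \<bullet> b)"
  by (simp add: sin_vec_def inner_sum_left inner_Basis if_distrib cong: if_cong)

lemma continuous_on_sin_vec: "continuous_on UNIV sin_vec"
  unfolding sin_vec_def by (intro continuous_intros)

lemma sin_vec_in_cbox: "sin_vec x \<in> cbox (- One) One"
  by (auto simp: mem_box sin_vec_inner)

text \<open>
  Links the two notions of polynomial: integrals of trigonometric polynomials are fixed by the
  characteristic function, while ordinary polynomials are uniformly dense on the cube that contains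
  the range of \<open>sin_vec\<close>.
\<close>

lemma trig_polynomial_real_polynomial_sin_vec:
  fixes q :: "'a::euclidean_space \<Rightarrow> real"
  assumes "real_polynomial_function q"
  shows "trig_polynomial (\<lambda>x. complex_of_real (q (sin_vec (r *\<^sub>R x))))"
  using assms
proof (induction q)
  case (linear f)
  then interpret f: bounded_linear f .
  have "complex_of_real (f (sin_vec (r *\<^sub>R x))) =
      (\<Sum>b\<in>Basis. complex_of_real (f b) * complex_of_real (sin ((r *\<^sub>R b) \<bullet> x)))" for x
    by (simp add: sin_vec_def f.sum f.scaleR inner_commute mult.commute)
  moreover have "trig_polynomial (\<lambda>x. \<Sum>b\<in>Basis.
      complex_of_real (f b) * complex_of_real (sin ((r *\<^sub>R b) \<bullet> x)))"
    by (intro trig_polynomial_sum trig_polynomial_mult trig_polynomial_const trig_polynomial_sin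
        finite_Basis)
  ultimately show ?case by presburger
next
  case (const c)
  then show ?case by (rule trig_polynomial_const)
next
  case (add f g)
  then show ?case by (simp add: trig_polynomial.add)
next
  case (mult f g)
  then show ?case by (simp add: trig_polynomial_mult)
qed

text \<open>
  This limit replaces a tightness argument: the bounded vector \<open>sin_vec (r *\<^sub>R x)\<close>, blown up by
  \<open>1 / r\<close>, recovers \<open>x\<close> because the sine has derivative 1 at 0.
\<close>

lemma tendsto_rescaled_sin_vec:
  "(\<lambda>n. real (Suc n) *\<^sub>R sin_vec (inverse (real (Suc n)) *\<^sub>R x)) \<longlonglongrightarrow> x"
proof -
  have lim: "(\<lambda>n. real (Suc n) * sin (inverse (real (Suc n)) * a)) \<longlonglongrightarrow> a" for a :: real
  proof -
    have "((\<lambda>h. sin (0 + h * a) / h) \<longlongrightarrow> a) (at 0)"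
    proof -
      have "((\<lambda>h. sin (h * a)) has_real_derivative a) (at 0)"
        by (auto intro!: derivative_eq_intros)
      then show ?thesis by (simp add: DERIV_def)
    qed
    moreover have "filterlim (\<lambda>n. inverse (real (Suc n))) (at 0) sequentially"
      using LIMSEQ_inverse_real_of_nat by (simp add: filterlim_at del: of_nat_Suc)
    ultimately have "(\<lambda>n. sin (0 + inverse (real (Suc n)) * a) / inverse (real (Suc n))) \<longlonglongrightarrow> a"
      by (rule filterlim_compose)
    then show ?thesis by (simp add: divide_inverse mult.commute del: of_nat_Suc)
  qed
  have "(\<lambda>n. \<Sum>b\<in>Basis. (real (Suc n) * sin (inverse (real (Suc n)) * (x \<bullet> b))) *\<^sub>R b)
      \<longlonglongrightarrow> (\<Sum>b\<in>Basis. (x \<bullet> b) *\<^sub>R b)"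
    by (intro tendsto_sum tendsto_scaleR tendsto_const lim)
  then show ?thesis
    by (simp add: sin_vec_def scaleR_sum_right euclidean_representation del: of_nat_Suc)
qed

text \<open>
  Uniform approximation by polynomials is only available on a compact set, while \<open>P\<close> and \<open>Q\<close>
  live on the whole space. Composing with \<open>sin_vec\<close> moves every integrand to a cube, so that no
  mass outside a compact set has to be controlled.
\<close>

theorem measure_eqI_char:
  fixes P Q :: "'a::euclidean_space measure"
  assumes P: "prob_space P" "sets P = sets borel" and Q: "prob_space Q" "sets Q = sets borel"
    and char_eq: "\<And>t. (\<integral>x. cis (t \<bullet> x) \<partial>P) = (\<integral>x. cis (t \<bullet> x) \<partial>Q)"
  shows "P = Q"
proof (rule measure_eqI_bounded_continuous[OF P Q])
  fix f :: "'a \<Rightarrow> real"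
  assume cont: "continuous_on UNIV f" and bd: "\<And>x. \<bar>f x\<bar> \<le> 1"
  have sin_cont: "continuous_on UNIV (\<lambda>x. g (sin_vec (r *\<^sub>R x)))"
    if "continuous_on UNIV g" for g :: "'a \<Rightarrow> real" and r
    by (intro continuous_on_compose2[OF that] continuous_on_compose2[OF continuous_on_sin_vec]
          continuous_intros) auto
  have int: "integrable R (\<lambda>x. g (sin_vec (r *\<^sub>R x)))"
    if R: "prob_space R" "sets R = sets borel" and g: "continuous_on UNIV g"
    for R :: "'a measure" and g :: "'a \<Rightarrow> real" and r
  proof -
    interpret R: prob_space R by fact
    note [measurable_cong] = R(2)
    have [measurable]: "(\<lambda>x. g (sin_vec (r *\<^sub>R x))) \<in> borel_measurable borel"
      by (rule borel_measurable_continuous_onI[OF sin_cont[OF g]])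
    have "compact (g ` cbox (- One) One)"
      by (intro compact_continuous_image continuous_on_subset[OF g]) auto
    then obtain B where "\<And>y. y \<in> cbox (- One) One \<Longrightarrow> norm (g y) \<le> B"
      by (meson bounded_iff compact_imp_bounded imageI)
    then show ?thesis
      by (intro R.integrable_const_bound[where B = B]) (auto simp: sin_vec_in_cbox)
  qed
  have cube_eq: "(\<integral>x. g (sin_vec (r *\<^sub>R x)) \<partial>P) = (\<integral>x. g (sin_vec (r *\<^sub>R x)) \<partial>Q)"
    if g: "continuous_on UNIV g" for g :: "'a \<Rightarrow> real" and r
  proof -
    let ?I = "\<lambda>R h. \<integral>x. h (sin_vec (r *\<^sub>R x)) \<partial>R"
    have "\<bar>?I P g - ?I Q g\<bar> \<le> e" if e: "e > 0" for e :: real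
    proof -
      obtain q where q: "real_polynomial_function q"
        and qe: "\<And>y. y \<in> cbox (- One) One \<Longrightarrow> \<bar>g y - q y\<bar> < e / 2"
        using Stone_Weierstrass_real_polynomial_function[OF compact_cbox continuous_on_subset[OF g subset_UNIV] half_gt_zero[OF e]]
        by blast
      have qc: "continuous_on UNIV q"
        using q by (simp add: continuous_on_polymonial_function real_polynomial_function_eq)
      have near: "\<bar>?I R g - ?I R q\<bar> \<le> e / 2"
        if R: "prob_space R" "sets R = sets borel" for R :: "'a measure"
      proof -
        interpret R: prob_space R by fact
        have "\<bar>?I R g - ?I R q\<bar> = \<bar>\<integral>x. g (sin_vec (r *\<^sub>R x)) - q (sin_vec (r *\<^sub>R x)) \<partial>R\<bar>"
          using int[OF R g] int[OF R qc] by simp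
        also have "\<dots> \<le> (\<integral>x. \<bar>g (sin_vec (r *\<^sub>R x)) - q (sin_vec (r *\<^sub>R x))\<bar> \<partial>R)"
          by (rule integral_abs_bound)
        also have "\<dots> \<le> (\<integral>x. e / 2 \<partial>R)"
          using int[OF R g] int[OF R qc] qe[OF sin_vec_in_cbox]
          by (intro integral_mono integrable_abs) (auto intro: less_imp_le)
        finally show ?thesis by (simp add: R.prob_space)
      qed
      have "?I P q = ?I Q q"
        using integral_trig_polynomial_eq[OF P Q char_eq trig_polynomial_real_polynomial_sin_vec[OF q, of r]]
        by simp
      then show ?thesis
        using near[OF P] near[OF Q] by linarith
    qed
    then have "\<bar>?I P g - ?I Q g\<bar> \<le> 0" by (rule field_le_epsilon[of _ 0, simplified]) 
    then show ?thesis by simp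
  qed
  \<comment> \<open>\<open>cube_eq\<close> applies to \<open>?h n\<close> with \<open>r = 1 / Suc n\<close> and \<open>g y = f (Suc n *\<^sub>R y)\<close>.\<close>
  let ?h = "\<lambda>n x. f (real (Suc n) *\<^sub>R sin_vec (inverse (real (Suc n)) *\<^sub>R x))"
  have f_scale: "continuous_on UNIV (\<lambda>y. f (c *\<^sub>R y))" for c
    by (intro continuous_on_compose2[OF cont] continuous_intros) auto
  have conv: "(\<lambda>n. \<integral>x. ?h n x \<partial>R) \<longlonglongrightarrow> (\<integral>x. f x \<partial>R)"
    if R: "prob_space R" "sets R = sets borel" for R :: "'a measure"
  proof (rule integral_dominated_convergence[where w = "\<lambda>_. 1"])
    interpret R: prob_space R by fact
    show "integrable R (\<lambda>_. 1 :: real)" by simp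
    show "f \<in> borel_measurable R"
      using borel_measurable_continuous_onI[OF cont] measurable_cong_sets[OF R(2) refl] by blast
    show "?h n \<in> borel_measurable R" for n
      using int[OF R f_scale] by (rule borel_measurable_integrable)
    have "(\<lambda>n. ?h n x) \<longlonglongrightarrow> f x" for x
      by (rule isCont_tendsto_compose[OF _ tendsto_rescaled_sin_vec])
        (use cont in \<open>simp add: continuous_on_eq_continuous_at\<close>)
    then show "AE x in R. (\<lambda>n. ?h n x) \<longlonglongrightarrow> f x" by simp
    show "AE x in R. norm (?h n x) \<le> 1" for n using bd by simp
  qed
  have "(\<integral>x. ?h n x \<partial>P) = (\<integral>x. ?h n x \<partial>Q)" for n
    using cube_eq[OF f_scale] .
  then show "(\<integral>x. f x \<partial>P) = (\<integral>x. f x \<partial>Q)"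
    using conv[OF P] conv[OF Q] by (simp add: LIMSEQ_unique)
qed

section \<open>One-dimensional normal laws\<close>

lemma (in prob_space) normally_distributed_moments:
  assumes "normally_distributed M X m v"
  shows "integrable M X" "expectation X = m"
    and "integrable M (\<lambda>\<omega>. (X \<omega> - m)\<^sup>2)" "expectation (\<lambda>\<omega>. (X \<omega> - m)\<^sup>2) = v"
proof -
  have meas[measurable]: "X \<in> borel_measurable M"
    using assms by (simp add: normally_distributed_def)
  have "integrable M X \<and> expectation X = m \<and>
      integrable M (\<lambda>\<omega>. (X \<omega> - m)\<^sup>2) \<and> expectation (\<lambda>\<omega>. (X \<omega> - m)\<^sup>2) = v"
  proof (cases "v > 0")
    case True
    then have D: "distributed M lborel X (normal_density m (sqrt v))"
      using assms by (simp add: normally_distributed_def)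
    have s: "0 < sqrt v" using True by simp
    have "integrable M X"
      using distributed_integrable[OF D, of "\<lambda>x. x"] integrable_normal_moment_nz_1[OF s] by simp
    moreover have E: "expectation X = m" by (rule normal_distributed_expectation[OF s D])
    moreover have "integrable M (\<lambda>\<omega>. (X \<omega> - m)\<^sup>2)"
      using distributed_integrable[OF D, of "\<lambda>x. (x - m)\<^sup>2"] integrable_normal_moment[OF s, of m 2] by simp
    ultimately show ?thesis
      using normal_distributed_variance[OF s D] True by simp
  next
    case False
    then have ae: "AE \<omega> in M. X \<omega> = m" and v: "v = 0"
      using assms by (auto simp: normally_distributed_def)
    have "integrable M X"
      using ae by (subst integrable_cong_AE[where g = "\<lambda>_. m"]) auto
    moreover have "expectation X = expectation (\<lambda>_. m)"
      using ae by (intro integral_cong_AE) auto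
    moreover have "integrable M (\<lambda>\<omega>. (X \<omega> - m)\<^sup>2)"
      using ae by (subst integrable_cong_AE[where g = "\<lambda>_. 0"]) auto
    moreover have "expectation (\<lambda>\<omega>. (X \<omega> - m)\<^sup>2) = expectation (\<lambda>_. 0)"
      using ae by (intro integral_cong_AE) auto
    ultimately show ?thesis using v by (simp add: prob_space)
  qed
  then show "integrable M X" "expectation X = m"
    "integrable M (\<lambda>\<omega>. (X \<omega> - m)\<^sup>2)" "expectation (\<lambda>\<omega>. (X \<omega> - m)\<^sup>2) = v" by auto
qed

lemma (in prob_space) char_normally_distributed:
  assumes "normally_distributed M X 0 v"
  shows "expectation (\<lambda>\<omega>. cis (t * X \<omega>)) = exp (- (v * t\<^sup>2) / 2)"
proof (cases "v > 0")
  case True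
  then have "distributed M lborel X (normal_density 0 (sqrt v))"
    using assms by (simp add: normally_distributed_def)
  then have D: "distributed M lborel (\<lambda>\<omega>. X \<omega> / sqrt v) std_normal_density"
    using normal_standard_normal_convert[of "sqrt v" X 0] True by simp
  have [measurable]: "X \<in> borel_measurable M"
    using assms by (simp add: normally_distributed_def)
  have law: "distr M borel (\<lambda>\<omega>. X \<omega> / sqrt v) = std_normal_distribution"
    using distributed_distr_eq_density[OF D] by (simp cong: distr_cong)
  have "expectation (\<lambda>\<omega>. cis (t * X \<omega>)) = expectation (\<lambda>\<omega>. cis ((t * sqrt v) * (X \<omega> / sqrt v)))"
    using True by simp
  also have "\<dots> = (\<integral>x. cis ((t * sqrt v) * x) \<partial>std_normal_distribution)"
    unfolding law[symmetric] by (subst integral_distr) auto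
  also have "\<dots> = char std_normal_distribution (t * sqrt v)"
    by (simp add: char_def cis_conv_exp)
  also have "\<dots> = exp (- (v * t\<^sup>2) / 2)"
    using True by (simp add: char_std_normal_distribution power_mult_distrib mult.commute)
  finally show ?thesis .
next
  case False
  then have ae: "AE \<omega> in M. X \<omega> = 0" and v: "v = 0"
    and [measurable]: "X \<in> borel_measurable M"
    using assms by (auto simp: normally_distributed_def)
  have "expectation (\<lambda>\<omega>. cis (t * X \<omega>)) = expectation (\<lambda>_. 1)"
    using ae by (intro integral_cong_AE) auto
  then show ?thesis by (simp add: v prob_space)
qed

definition normal_law :: "real \<Rightarrow> real measure" where
  "normal_law v = (if v = 0 then return borel 0 else density lborel (normal_density 0 (sqrt v)))"

lemma sets_normal_law [simp, measurable_cong]: "sets (normal_law v) = sets borel"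
  by (simp add: normal_law_def)

lemma prob_space_normal_law: "0 \<le> v \<Longrightarrow> prob_space (normal_law v)"
  by (auto simp: normal_law_def prob_space_return intro!: prob_space_normal_density)

lemma normally_distributed_if_distr_eq:
  assumes X: "X \<in> borel_measurable M" and v: "0 \<le> v" and law: "distr M borel X = normal_law v"
  shows "normally_distributed M X 0 v"
proof (cases "v = 0")
  case True
  then have "AE x in distr M borel X. x = 0"
    unfolding law normal_law_def by (simp add: AE_return True)
  then have "AE \<omega> in M. X \<omega> = 0"
    using X by (subst (asm) AE_distr_iff) auto
  then show ?thesis using X True by (simp add: normally_distributed_def)
next
  case False
  have "distr M lborel X = distr M borel X" by (rule distr_cong) auto
  then have "distributed M lborel X (normal_density 0 (sqrt v))"
    using X law False by (auto simp: distributed_def normal_law_def)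
  then show ?thesis using X v False by (simp add: normally_distributed_def)
qed

section \<open>The characteristic functions of both sides\<close>

lemma equicorrelation_matrix_entry:
  "(equicorrelation_matrix \<rho> :: real ^ 'n ^ 'n) $ i $ j = (1 - \<rho>) * (if i = j then 1 else 0) + \<rho>"
  by (simp add: equicorrelation_matrix_def mat_def matrix_matrix_mult_def columnvector_def
      rowvector_def)

lemma equicorrelation_quadratic_form:
  fixes a :: "real ^ 'n"
  shows "(\<Sum>i\<in>UNIV. \<Sum>j\<in>UNIV. a $ i * a $ j * (equicorrelation_matrix \<rho> :: real ^ 'n ^ 'n) $ i $ j) =
    (1 - \<rho>) * (\<Sum>i\<in>UNIV. (a $ i)\<^sup>2) + \<rho> * (\<Sum>i\<in>UNIV. a $ i)\<^sup>2"
proof -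
  have "(\<Sum>j\<in>UNIV. a $ i * a $ j * (equicorrelation_matrix \<rho> :: real ^ 'n ^ 'n) $ i $ j) =
      (1 - \<rho>) * (a $ i)\<^sup>2 + \<rho> * (a $ i * (\<Sum>j\<in>UNIV. a $ j))" for i
  proof -
    have "a $ i * a $ j * (equicorrelation_matrix \<rho> :: real ^ 'n ^ 'n) $ i $ j =
        (if i = j then (1 - \<rho>) * (a $ i)\<^sup>2 else 0) + \<rho> * (a $ i * a $ j)" for j
      by (simp add: equicorrelation_matrix_entry power2_eq_square algebra_simps)
    then show ?thesis
      by (simp add: sum.distrib flip: sum_distrib_left)
  qed
  then show ?thesis
    by (simp add: sum.distrib power2_eq_square flip: sum_distrib_left sum_distrib_right)
qed

text \<open>
  Each linear combination is only known to be normal with some parameters. Its first two moments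
  identify them: the mean is 0 and the variance is the quadratic form of the covariance matrix.
\<close>

lemma (in prob_space) char_multivariate_normal:
  fixes U :: "'a \<Rightarrow> real ^ 'n"
  assumes "multivariate_normal M U 0 S"
  shows "expectation (\<lambda>\<omega>. cis (a \<bullet> U \<omega>)) =
    exp (- (\<Sum>i\<in>UNIV. \<Sum>j\<in>UNIV. a $ i * a $ j * S $ i $ j) / 2)"
proof -
  have [measurable]: "U \<in> borel_measurable M"
    and lin: "\<And>b. \<exists>\<mu> v. normally_distributed M (\<lambda>\<omega>. b \<bullet> U \<omega>) \<mu> v"
    and mean: "mean_vector M U = 0" and cov: "covariance_matrix M U = S"
    using assms by (auto simp: multivariate_normal_def)
  \<comment> \<open>Normality along the coordinate axes supplies the integrability needed to expand the variance.\<close>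
  have comp: "integrable M (\<lambda>\<omega>. U \<omega> $ i)" "expectation (\<lambda>\<omega>. U \<omega> $ i) = 0"
    and square: "integrable M (\<lambda>\<omega>. (U \<omega> $ i)\<^sup>2)" for i
  proof -
    obtain \<mu> v where N: "normally_distributed M (\<lambda>\<omega>. axis i 1 \<bullet> U \<omega>) \<mu> v"
      using lin by blast
    show "expectation (\<lambda>\<omega>. U \<omega> $ i) = 0"
      using arg_cong[OF mean, of "\<lambda>x. x $ i"] by (simp add: mean_vector_def)
    then have "\<mu> = 0"
      using normally_distributed_moments(2)[OF N] by (simp add: inner_axis')
    then show "integrable M (\<lambda>\<omega>. U \<omega> $ i)" "integrable M (\<lambda>\<omega>. (U \<omega> $ i)\<^sup>2)"
      using normally_distributed_moments(1,3)[OF N] by (simp_all add: inner_axis')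
  qed
  have prod: "integrable M (\<lambda>\<omega>. U \<omega> $ i * U \<omega> $ j)" for i j
  proof (rule Bochner_Integration.integrable_bound)
    show "integrable M (\<lambda>\<omega>. (U \<omega> $ i)\<^sup>2 + (U \<omega> $ j)\<^sup>2)"
      using square by simp
    have "\<bar>x * y\<bar> \<le> \<bar>x\<^sup>2 + y\<^sup>2\<bar>" for x y :: real
    proof -
      have "0 \<le> (\<bar>x\<bar> - \<bar>y\<bar>)\<^sup>2" by simp
      then have "2 * \<bar>x * y\<bar> \<le> x\<^sup>2 + y\<^sup>2" by (simp add: power2_diff abs_mult)
      then show ?thesis by simp
    qed
    then show "AE \<omega> in M. norm (U \<omega> $ i * U \<omega> $ j) \<le> norm ((U \<omega> $ i)\<^sup>2 + (U \<omega> $ j)\<^sup>2)"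
      by simp
    show "(\<lambda>\<omega>. U \<omega> $ i * U \<omega> $ j) \<in> borel_measurable M"
      by (intro borel_measurable_times borel_measurable_integrable[OF comp(1)])
  qed
  have S: "expectation (\<lambda>\<omega>. U \<omega> $ i * U \<omega> $ j) = S $ i $ j" for i j
    using arg_cong[OF cov, of "\<lambda>x. x $ i $ j"] by (simp add: covariance_matrix_def mean)
  have inner: "a \<bullet> U \<omega> = (\<Sum>i\<in>UNIV. a $ i * U \<omega> $ i)" for \<omega>
    by (simp add: inner_vec_def)
  obtain \<mu> v where N: "normally_distributed M (\<lambda>\<omega>. a \<bullet> U \<omega>) \<mu> v"
    using lin by blast
  have \<mu>: "\<mu> = 0"
    using normally_distributed_moments(2)[OF N] comp by (simp add: inner)
  have "v = expectation (\<lambda>\<omega>. (a \<bullet> U \<omega>)\<^sup>2)"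
    using normally_distributed_moments(4)[OF N] \<mu> by simp
  also have "\<dots> = expectation (\<lambda>\<omega>. \<Sum>i\<in>UNIV. \<Sum>j\<in>UNIV. (a $ i * a $ j) * (U \<omega> $ i * U \<omega> $ j))"
    by (simp add: inner power2_eq_square sum_product ac_simps)
  also have "\<dots> = (\<Sum>i\<in>UNIV. \<Sum>j\<in>UNIV. a $ i * a $ j * S $ i $ j)"
    using prod by (simp add: S)
  finally have v: "v = (\<Sum>i\<in>UNIV. \<Sum>j\<in>UNIV. a $ i * a $ j * S $ i $ j)" .
  show ?thesis
    using char_normally_distributed[OF N[unfolded \<mu>], of 1] by (simp add: v)
qed

lemma (in prob_space) char_common_shift:
  fixes Z :: "'n::finite \<Rightarrow> 'a \<Rightarrow> real" and a :: "real ^ 'n"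
  assumes ind: "indep_vars (\<lambda>_. borel) (case_option V Z) UNIV"
    and Z: "\<And>i. normally_distributed M (Z i) 0 \<sigma>" and V: "normally_distributed M V 0 \<tau>"
  shows "expectation (\<lambda>\<omega>. cis (a \<bullet> (\<chi> i. Z i \<omega> + V \<omega>))) =
    exp (- (\<sigma> * (\<Sum>i\<in>UNIV. (a $ i)\<^sup>2) + \<tau> * (\<Sum>i\<in>UNIV. a $ i)\<^sup>2) / 2)"
proof -
  let ?X = "case_option V Z"
  \<comment> \<open>The coefficients of the linear combination in terms of the independent family \<open>?X\<close>.\<close>
  define w where "w = case_option (\<Sum>i\<in>UNIV. a $ i) (\<lambda>i. a $ i)"
  have sum_option: "(\<Sum>k\<in>UNIV. h k) = h None + (\<Sum>i\<in>UNIV. h (Some i))"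
    for h :: "'n option \<Rightarrow> real"
    by (simp add: UNIV_option_conv sum.reindex)
  have prod_option: "(\<Prod>k\<in>UNIV. h k) = h None * (\<Prod>i\<in>UNIV. h (Some i))"
    for h :: "'n option \<Rightarrow> complex"
    by (simp add: UNIV_option_conv prod.reindex)
  have cis_sum: "cis (\<Sum>k\<in>A. h k) = (\<Prod>k\<in>A. cis (h k))" if "finite A"
    for h :: "'n option \<Rightarrow> real" and A
    using that by (induction A rule: finite_induct) (auto simp flip: cis_mult)
  have "a \<bullet> (\<chi> i. Z i \<omega> + V \<omega>) = (\<Sum>k\<in>UNIV. w k * ?X k \<omega>)" for \<omega>
    by (simp add: sum_option w_def inner_vec_def distrib_left sum.distrib sum_distrib_right)
  then have "expectation (\<lambda>\<omega>. cis (a \<bullet> (\<chi> i. Z i \<omega> + V \<omega>))) =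
      expectation (\<lambda>\<omega>. \<Prod>k\<in>UNIV. cis (w k * ?X k \<omega>))"
    by (simp add: cis_sum)
  also have "\<dots> = (\<Prod>k\<in>UNIV. expectation (\<lambda>\<omega>. cis (w k * ?X k \<omega>)))"
  proof (rule indep_vars_lebesgue_integral)
    show "indep_vars (\<lambda>_. borel) (\<lambda>k \<omega>. cis (w k * ?X k \<omega>)) UNIV"
      by (rule indep_vars_compose2[OF ind]) measurable
    have [measurable]: "?X k \<in> borel_measurable M" for k
      using ind by (simp add: indep_vars_def2)
    show "integrable M (\<lambda>\<omega>. cis (w k * ?X k \<omega>))" for k
      by (rule integrable_const_bound[where B = 1]) auto
  qed simp
  also have "\<dots> = (\<Prod>k\<in>UNIV. complex_of_real (exp (- ((case k of None \<Rightarrow> \<tau> | Some _ \<Rightarrow> \<sigma>) * (w k)\<^sup>2) / 2)))"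
    using char_normally_distributed[OF V] char_normally_distributed[OF Z]
    by (intro prod.cong) (auto split: option.split)
  also have "\<dots> = complex_of_real (exp (\<Sum>k\<in>UNIV. - ((case k of None \<Rightarrow> \<tau> | Some _ \<Rightarrow> \<sigma>) * (w k)\<^sup>2) / 2))"
    by (simp add: exp_sum)
  also have "(\<Sum>k\<in>UNIV. - ((case k of None \<Rightarrow> \<tau> | Some _ \<Rightarrow> \<sigma>) * (w k)\<^sup>2) / 2) =
      - (\<sigma> * (\<Sum>i\<in>UNIV. (a $ i)\<^sup>2) + \<tau> * (\<Sum>i\<in>UNIV. a $ i)\<^sup>2) / 2"
    by (simp add: sum_option w_def sum_negf add_divide_distrib
        flip: sum_divide_distrib sum_distrib_left)
  finally show ?thesis .
qed

section \<open>The decomposition\<close>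

lemma ex_indep_normal_family:
  fixes v :: "'i::finite \<Rightarrow> real"
  assumes v: "\<And>i. 0 \<le> v i"
  shows "\<exists>N :: ('i \<Rightarrow> real) measure. prob_space N \<and>
    prob_space.indep_vars N (\<lambda>_. borel) (\<lambda>i \<omega>. \<omega> i) UNIV \<and>
    (\<forall>i. normally_distributed N (\<lambda>\<omega>. \<omega> i) 0 (v i))"
proof -
  define N where "N = PiM UNIV (\<lambda>i. normal_law (v i))"
  have law: "prob_space (normal_law (v i))" for i
    using v by (rule prob_space_normal_law)
  interpret N: prob_space N
    unfolding N_def by (rule prob_space_PiM) (rule law)
  have sets_N [measurable_cong]: "sets N = sets (PiM UNIV (\<lambda>_. borel))"
    unfolding N_def by (rule sets_PiM_cong) auto
  have distr_coord: "distr N borel (\<lambda>\<omega>. \<omega> i) = normal_law (v i)" for i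
  proof -
    have "distr N borel (\<lambda>\<omega>. \<omega> i) = distr N (normal_law (v i)) (\<lambda>\<omega>. \<omega> i)"
      by (rule distr_cong) auto
    then show ?thesis
      unfolding N_def using distr_PiM_component[of UNIV "\<lambda>i. normal_law (v i)" i] law by simp
  qed
  have "N.indep_vars (\<lambda>_. borel) (\<lambda>i \<omega>. \<omega> i) UNIV"
  proof (subst N.indep_vars_iff_distr_eq_PiM)
    have "distr N (PiM UNIV (\<lambda>_. borel)) (\<lambda>x. \<lambda>i\<in>UNIV. x i) = distr N N (\<lambda>x. x)"
      by (rule distr_cong) (auto simp: sets_N)
    also have "\<dots> = PiM UNIV (\<lambda>i. distr N borel (\<lambda>\<omega>. \<omega> i))"
      by (simp add: distr_coord) (simp add: N_def)
    finally show "distr N (PiM UNIV (\<lambda>_. borel)) (\<lambda>x. \<lambda>i\<in>UNIV. x i) =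
        PiM UNIV (\<lambda>i. distr N borel (\<lambda>\<omega>. \<omega> i))" .
  qed auto
  moreover have "normally_distributed N (\<lambda>\<omega>. \<omega> i) 0 (v i)" for i
    by (rule normally_distributed_if_distr_eq) (auto simp: v distr_coord)
  ultimately show ?thesis
    using N.prob_space_axioms by blast
qed

theorem mainTheorem1:
  fixes M :: "'a measure" and U :: "'a \<Rightarrow> real ^ 'n" and \<rho> :: real
  assumes "prob_space M"
    and "0 \<le> \<rho>" and "\<rho> \<le> 1"
    and "multivariate_normal M U 0 (equicorrelation_matrix \<rho>)"
  shows "\<exists>(N :: ('n option \<Rightarrow> real) measure) Z V.
           prob_space N \<and>
           prob_space.indep_vars N (\<lambda>_. borel) (case_option V Z) (UNIV :: 'n option set) \<and>
           (\<forall>i :: 'n. normally_distributed N (Z i) 0 (1 - \<rho>)) \<and>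
           normally_distributed N V 0 \<rho> \<and>
           distr M borel U = distr N borel (\<lambda>\<omega>. \<chi> i. Z i \<omega> + V \<omega>)"
proof -
  interpret M: prob_space M by fact
  obtain N :: "('n option \<Rightarrow> real) measure" where N: "prob_space N"
    and ind: "prob_space.indep_vars N (\<lambda>_. borel) (\<lambda>k \<omega>. \<omega> k) UNIV"
    and normal: "\<And>k. normally_distributed N (\<lambda>\<omega>. \<omega> k) 0 (case k of None \<Rightarrow> \<rho> | Some _ \<Rightarrow> 1 - \<rho>)"
  proof -
    have "0 \<le> (case k of None \<Rightarrow> \<rho> | Some (_ :: 'n) \<Rightarrow> 1 - \<rho>)" for k
      using assms(2,3) by (simp split: option.split)
    from ex_indep_normal_family[of "case_option \<rho> (\<lambda>_ :: 'n. 1 - \<rho>)", OF this] show ?thesis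
      using that by blast
  qed
  interpret N: prob_space N by fact
  define V :: "('n option \<Rightarrow> real) \<Rightarrow> real" where "V \<omega> = \<omega> None" for \<omega>
  define Z :: "'n \<Rightarrow> ('n option \<Rightarrow> real) \<Rightarrow> real" where "Z i \<omega> = \<omega> (Some i)" for i \<omega>
  have "case_option V Z = (\<lambda>k \<omega>. \<omega> k)"
    by (auto simp: fun_eq_iff V_def Z_def split: option.split)
  then have ind': "N.indep_vars (\<lambda>_. borel) (case_option V Z) UNIV"
    using ind by simp
  have Z: "normally_distributed N (Z i) 0 (1 - \<rho>)" for i
    using normal[of "Some i"] by (simp add: Z_def[abs_def])
  have V: "normally_distributed N V 0 \<rho>"
    using normal[of None] by (simp add: V_def[abs_def])
  have [measurable]: "Z i \<in> borel_measurable N" "V \<in> borel_measurable N" for i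
    using Z V by (simp_all add: normally_distributed_def)
  have [measurable]: "U \<in> borel_measurable M"
    using assms(4) by (simp add: multivariate_normal_def)
  let ?W = "\<lambda>\<omega>. (\<chi> i. Z i \<omega> + V \<omega>) :: real ^ 'n"
  have [measurable]: "?W \<in> borel_measurable N"
    unfolding borel_measurable_euclidean_space[of ?W] by (auto simp: Basis_vec_def inner_axis)
  have "distr M borel U = distr N borel ?W"
  proof (rule measure_eqI_char)
    show "prob_space (distr M borel U)" by (rule M.prob_space_distr) measurable
    show "prob_space (distr N borel ?W)" by (rule N.prob_space_distr) measurable
    fix a :: "real ^ 'n"
    have "(\<integral>x. cis (a \<bullet> x) \<partial>distr M borel U) = M.expectation (\<lambda>\<omega>. cis (a \<bullet> U \<omega>))"
      by (rule integral_distr) measurable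
    also have "\<dots> = N.expectation (\<lambda>\<omega>. cis (a \<bullet> ?W \<omega>))"
      unfolding M.char_multivariate_normal[OF assms(4)] equicorrelation_quadratic_form
        N.char_common_shift[OF ind' Z V] ..
    also have "\<dots> = (\<integral>x. cis (a \<bullet> x) \<partial>distr N borel ?W)"
      by (rule integral_distr[symmetric]) measurable
    finally show "(\<integral>x. cis (a \<bullet> x) \<partial>distr M borel U) = (\<integral>x. cis (a \<bullet> x) \<partial>distr N borel ?W)" .
  qed auto
  then show ?thesis
    using N ind' Z V by blast
qed

end
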